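(* Let $1\le K\le\lfloor N/2\rfloor$ and let $\rho$ be a density operator on the one-particle space $\mathcal{H}_1^{\bm{\mathsf{A}}}=\mathrm{span}\{|\mathbf{e}_1\rangle,\dots,|\mathbf{e}_N\rangle\}$. Then $\rho$ can produce an $(N,K)$-local quantum MAC (an element of $\mathcal{Q}_{N,K}$ with initial state $\rho$) that exhibits non-vanishing $2K$-order interference if and only if $\rho$ has some off-diagonal term $\rho_{ij}=\langle\mathbf{e}_i|\rho|\mathbf{e}_j\rangle\neq0$ with $i\ne j$.
   Context: There are $N$ modes, one per sender, each with vacuum $|0\rangle$ and one-particle state $|1\rangle$; $|\mathbf{e}_i\rangle$ is the state with one particle in mode $i$ and none elsewhere. Inputs $a_i$ and output $b$ are binary (in $\{0,1\}$). Joint NPE operation on a group $S$ of modes (at most one particle): a convex combination of channels on operators on $F_S=\mathrm{span}\{|0\rangle_S,|\mathbf{e}_s\rangle:s\in S\}$ ($|0\rangle_S$ = vacuum of $S$) of the form $X\mapsto\mathrm{Tr}_{E}[U(X\otimes|0\rangle\langle0|_E)U^\dagger]$, where $E$ consists of finitely many ancilla modes initially in vacuum and $U$ is a unitary on the span of states of $S\cup E$ with total particle number at most one which preserves total particle number (maps the vacuum line to itself and the one-particle subspace to itself). $(N,K)$-local quantum MACs $\mathcal{Q}_{N,K}$: MACs of the form $p(b|a_1\cdots a_N)=\mathrm{Tr}\left[\Pi_b\left(\bigotimes_{g=1}^G\mathcal{E}^{S_g}_{(a_s)_{s\in S_g}}\right)(\rho)\right]$, where $\rho$ is a density operator on $\mathcal{H}_1^{\bm{\mathsf{A}}}$,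 $\{S_1,\dots,S_G\}$ is a partition of $\{1,\dots,N\}$ into groups of size at most $K$, each $\mathcal{E}^{S_g}_{(a_s)_{s\in S_g}}$ is a joint NPE operation on group $S_g$ depending only on the inputs of that group, and $\{\Pi_b\}$ is a POVM. $k$-th order interference: for $S\subseteq\{1,\dots,N\}$ with $|S|=k$ and fixed inputs of the senders outside $S$, consider $\sum_{(a_s)_{s\in S}\in\{0,1\}^S}\prod_{s\in S}(-1)^{a_s}\,p(0|a_1\cdots a_N)$. A MAC has non-vanishing $k$-order interference if this is nonzero for some $S$ with $|S|=k$ and some fixed inputs outside $S$. *)

theory Defs
  imports
    Complex_Main
    "HOL-Library.FuncSet"
    "HOL-Library.Disjoint_Sets"
    "HOL-Library.Nonpos_Ints"
begin

text \<open>
  Modes are labelled by natural numbers. An occupation-number basis vector with at most one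
  particle per mode is encoded by the set of its occupied modes: the vacuum is \<open>{}\<close>, and
  \<open>|e\<^sub>i\<rangle>\<close> is \<open>{i}\<close>. An operator \<open>X\<close> on the space spanned by a finite set \<open>B\<close> of such
  configurations is given by its matrix entries \<open>X R T = \<langle>R|X|T\<rangle>\<close>, which are required to
  vanish outside \<open>B\<close>.
\<close>

type_synonym config = "nat set"
type_synonym oper = "config \<Rightarrow> config \<Rightarrow> complex"

definition is_oper :: "config set \<Rightarrow> oper \<Rightarrow> bool" where
  "is_oper B X \<longleftrightarrow> (\<forall>R T. R \<notin> B \<or> T \<notin> B \<longrightarrow> X R T = 0)"

definition id_oper :: "config set \<Rightarrow> oper" where
  "id_oper B = (\<lambda>R T. if R \<in> B \<and> R = T then 1 else 0)"

definition mult_oper :: "config set \<Rightarrow> oper \<Rightarrow> oper \<Rightarrow> oper" where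
  "mult_oper B X Y = (\<lambda>R T. \<Sum>Q\<in>B. X R Q * Y Q T)"

definition adj_oper :: "oper \<Rightarrow> oper" where
  "adj_oper X = (\<lambda>R T. cnj (X T R))"

definition trace_oper :: "config set \<Rightarrow> oper \<Rightarrow> complex" where
  "trace_oper B X = (\<Sum>R\<in>B. X R R)"

definition ketbra :: "config \<Rightarrow> config \<Rightarrow> oper" where
  "ketbra R T = (\<lambda>R' T'. if R' = R \<and> T' = T then 1 else 0)"

definition positive_oper :: "config set \<Rightarrow> oper \<Rightarrow> bool" where
  "positive_oper B X \<longleftrightarrow> is_oper B X \<and>
     (\<forall>v. (\<Sum>R\<in>B. \<Sum>T\<in>B. cnj (v R) * X R T * v T) \<in> \<real>\<^sub>\<ge>\<^sub>0)"

definition density_oper :: "config set \<Rightarrow> oper \<Rightarrow> bool" where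
  "density_oper B X \<longleftrightarrow> positive_oper B X \<and> trace_oper B X = 1"

definition unitary_oper :: "config set \<Rightarrow> oper \<Rightarrow> bool" where
  "unitary_oper B U \<longleftrightarrow> is_oper B U \<and>
     mult_oper B (adj_oper U) U = id_oper B \<and> mult_oper B U (adj_oper U) = id_oper B"

text \<open>The basis of \<open>F\<^sub>S\<close>, for a finite set \<open>S\<close> of modes, and that of the one-particle space.\<close>

definition F_basis :: "nat set \<Rightarrow> config set" where
  "F_basis S = {R. R \<subseteq> S \<and> card R \<le> 1}"

definition H1_basis :: "nat \<Rightarrow> config set" where
  "H1_basis N = (\<lambda>i. {i}) ` {1..N}"

definition number_preserving :: "config set \<Rightarrow> oper \<Rightarrow> bool" where
  "number_preserving B U \<longleftrightarrow> (\<forall>R\<in>B. \<forall>T\<in>B. card R \<noteq> card T \<longrightarrow> U R T = 0)"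

text \<open>
  \<open>X \<otimes> Y\<close> for operators on two disjoint sets \<open>S\<close>, \<open>E\<close> of modes: a configuration
  \<open>R \<subseteq> S \<union> E\<close> stands for the product vector \<open>|R \<inter> S\<rangle> \<otimes> |R \<inter> E\<rangle>\<close>.
\<close>

definition tensor_oper :: "nat set \<Rightarrow> nat set \<Rightarrow> oper \<Rightarrow> oper \<Rightarrow> oper" where
  "tensor_oper S E X Y =
     (\<lambda>R T. if R \<subseteq> S \<union> E \<and> T \<subseteq> S \<union> E then X (R \<inter> S) (T \<inter> S) * Y (R \<inter> E) (T \<inter> E) else 0)"

definition partial_trace :: "nat set \<Rightarrow> nat set \<Rightarrow> oper \<Rightarrow> oper" where
  "partial_trace S E Y =
     (\<lambda>R T. if R \<in> F_basis S \<and> T \<in> F_basis S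
            then \<Sum>Q\<in>F_basis E. Y (R \<union> Q) (T \<union> Q) else 0)"

text \<open>
  \<open>X \<mapsto> Tr\<^sub>E[U (X \<otimes> |0\<rangle>\<langle>0|\<^sub>E) U\<^sup>\<dagger>]\<close>, with \<open>U\<close> acting on the span of the states of
  \<open>S \<union> E\<close> with at most one particle in total.
\<close>

definition dilation_map :: "nat set \<Rightarrow> nat set \<Rightarrow> oper \<Rightarrow> oper \<Rightarrow> oper" where
  "dilation_map S E U X =
     partial_trace S E
       (mult_oper (F_basis (S \<union> E)) U
         (mult_oper (F_basis (S \<union> E)) (tensor_oper S E X (ketbra {} {})) (adj_oper U)))"

text \<open>
  The ancilla labels are local to each channel. They only have to differ from the labels in \<open>S\<close>,
  so this imposes no bound on the number of ancillas.
\<close>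

definition joint_NPE :: "nat set \<Rightarrow> (oper \<Rightarrow> oper) \<Rightarrow> bool" where
  "joint_NPE S \<Phi> \<longleftrightarrow>
     (\<exists>(n::nat) (w::nat \<Rightarrow> real) E U.
        (\<forall>k<n. 0 \<le> w k) \<and> (\<Sum>k<n. w k) = 1 \<and>
        (\<forall>k<n. finite (E k) \<and> S \<inter> E k = {} \<and>
           unitary_oper (F_basis (S \<union> E k)) (U k) \<and>
           number_preserving (F_basis (S \<union> E k)) (U k)) \<and>
        \<Phi> = (\<lambda>X R T. \<Sum>k<n. complex_of_real (w k) * dilation_map S (E k) (U k) X R T))"

text \<open>
  The basis of the tensor product of the spaces \<open>F\<^sub>S\<close> over the groups \<open>S \<in> P\<close>, and the tensor
  product of linear maps acting on the factors: it sends \<open>|T\<rangle>\<langle>T'|\<close> to the tensor product of the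
  operators \<open>\<Phi>\<^sub>S(|T \<inter> S\<rangle>\<langle>T' \<inter> S|)\<close>, extended linearly. The one-particle space embeds because
  each \<open>{i}\<close> is such a configuration.
\<close>

definition prod_basis :: "nat set set \<Rightarrow> config set" where
  "prod_basis P = {R. R \<subseteq> \<Union>P \<and> (\<forall>S\<in>P. R \<inter> S \<in> F_basis S)}"

definition tensor_map :: "nat set set \<Rightarrow> (nat set \<Rightarrow> oper \<Rightarrow> oper) \<Rightarrow> oper \<Rightarrow> oper" where
  "tensor_map P \<Phi> X =
     (\<lambda>R R'. if R \<in> prod_basis P \<and> R' \<in> prod_basis P
             then \<Sum>T\<in>prod_basis P. \<Sum>T'\<in>prod_basis P.
                    X T T' * (\<Prod>S\<in>P. \<Phi> S (ketbra (T \<inter> S) (T' \<inter> S)) (R \<inter> S) (R' \<inter> S))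
             else 0)"

definition binary_POVM :: "config set \<Rightarrow> (nat \<Rightarrow> oper) \<Rightarrow> bool" where
  "binary_POVM B M \<longleftrightarrow> (\<forall>b\<in>{0, 1}. positive_oper B (M b)) \<and>
     (\<lambda>R T. \<Sum>b\<in>{0, 1}. M b R T) = id_oper B"

text \<open>Input strings of the senders in \<open>A\<close>.\<close>

abbreviation inputs :: "nat set \<Rightarrow> (nat \<Rightarrow> nat) set" where
  "inputs A \<equiv> A \<rightarrow>\<^sub>E {0, 1}"

text \<open>
  A MAC is a function \<open>p b a = p(b | a\<^sub>1 \<dots> a\<^sub>N)\<close>, relevant only for \<open>b \<in> {0, 1}\<close> and
  \<open>a \<in> inputs {1..N}\<close>. The following are the \<open>(N, K)\<close>-local quantum MACs with initial state
  \<open>\<rho>\<close>. The operation of a group is indexed by the restriction of \<open>a\<close> to that group, hence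
  depends only on the inputs of the group.
\<close>

definition local_quantum_MACs ::
    "nat \<Rightarrow> nat \<Rightarrow> oper \<Rightarrow> (nat \<Rightarrow> (nat \<Rightarrow> nat) \<Rightarrow> real) set" where
  "local_quantum_MACs N K \<rho> = {p. \<exists>P \<E> M.
     partition_on {1..N} P \<and> (\<forall>S\<in>P. card S \<le> K) \<and>
     (\<forall>S\<in>P. \<forall>a\<in>inputs S. joint_NPE S (\<E> S a)) \<and>
     binary_POVM (prod_basis P) M \<and>
     (\<forall>b\<in>{0, 1}. \<forall>a\<in>inputs {1..N}.
        complex_of_real (p b a) =
          trace_oper (prod_basis P)
            (mult_oper (prod_basis P) (M b) (tensor_map P (\<lambda>S. \<E> S (restrict a S)) \<rho>)))}"

text \<open>Here \<open>c\<close> holds the fixed inputs of the senders outside \<open>S\<close>.\<close>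

definition interference ::
    "(nat \<Rightarrow> (nat \<Rightarrow> nat) \<Rightarrow> real) \<Rightarrow> nat set \<Rightarrow> (nat \<Rightarrow> nat) \<Rightarrow> real" where
  "interference p S c = (\<Sum>a\<in>inputs S. (\<Prod>s\<in>S. (-1) ^ a s) * p 0 (override_on c a S))"

definition nonvanishing_interference ::
    "nat \<Rightarrow> nat \<Rightarrow> (nat \<Rightarrow> (nat \<Rightarrow> nat) \<Rightarrow> real) \<Rightarrow> bool" where
  "nonvanishing_interference N k p \<longleftrightarrow>
     (\<exists>S c. S \<subseteq> {1..N} \<and> card S = k \<and> c \<in> inputs ({1..N} - S) \<and> interference p S c \<noteq> 0)"

end

theory Submission
  imports Defs
begin

text \<open>
  A diagonal \<open>\<rho>\<close> is a mixture of localized particles. Number-preserving operations fix the vacuum,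
  so the statistics of a particle in mode \<open>k\<close> depend only on the inputs of the group of \<open>k\<close>. As
  this group has at most \<open>K < 2K\<close> senders, every alternating sum over \<open>2K\<close> senders cancels.

  Conversely, if \<open>\<rho>\<^sub>i\<^sub>j \<noteq> 0\<close>, put \<open>i\<close> and \<open>j\<close> in two disjoint groups of \<open>K\<close> senders each and let
  every group multiply its particle sector by the sign \<open>\<Prod>s. (-1) ^ a s\<close>. Measuring the observable
  \<open>u |e\<^sub>i\<rangle>\<langle>e\<^sub>j| + h.c.\<close> with the phase \<open>u\<close> matched to \<open>\<rho>\<^sub>i\<^sub>j\<close> makes the product of all \<open>2K\<close> signs
  appear in \<open>p(0|a)\<close> with the coefficient \<open>|\<rho>\<^sub>i\<^sub>j|\<close>.
\<close>

section \<open>Configuration bases and alternating sums\<close>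

lemma finite_F_basis: "finite S \<Longrightarrow> finite (F_basis S)"
  unfolding F_basis_def by (rule finite_subset[of _ "Pow S"]) auto

lemma F_basis_empty: "F_basis {} = {{}}"
  unfolding F_basis_def by auto

lemma empty_in_F_basis: "{} \<in> F_basis S"
  unfolding F_basis_def by auto

lemma finite_prod_basis: "finite (\<Union>P) \<Longrightarrow> finite (prod_basis P)"
  unfolding prod_basis_def by (rule finite_subset[of _ "Pow (\<Union>P)"]) auto

lemma singleton_in_prod_basis: "k \<in> \<Union>P \<Longrightarrow> {k} \<in> prod_basis P"
  unfolding prod_basis_def F_basis_def
  by (auto intro: card_mono[of "{k}", simplified])

lemma prod_basis_eqI:
  assumes "R \<in> prod_basis P" "T \<in> prod_basis P" "\<And>S. S \<in> P \<Longrightarrow> R \<inter> S = T \<inter> S"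
  shows "R = T"
  using assms unfolding prod_basis_def by blast

text \<open>Flipping the bit of \<open>s\<close> is an involution of \<open>inputs S\<close> that
  reverses the sign product and leaves \<open>f\<close> alone, so the sum equals its own negative.
  The truncated \<open>1 - a s\<close> is the flip because \<open>a s\<close> is 0 or 1.\<close>

lemma alternating_sum_eq_0:
  fixes f :: "(nat \<Rightarrow> nat) \<Rightarrow> complex"
  assumes "finite S" "s \<in> S"
    and inv: "\<And>a. a \<in> inputs S \<Longrightarrow> f (a(s := 1 - a s)) = f a"
  shows "(\<Sum>a\<in>inputs S. (\<Prod>s\<in>S. (-1) ^ a s) * f a) = 0"
proof -
  let ?h = "\<lambda>a::nat \<Rightarrow> nat. a(s := 1 - a s)"
  let ?g = "\<lambda>a::nat \<Rightarrow> nat. (\<Prod>s\<in>S. (-1) ^ a s) * f a"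
  have bin: "a s = 0 \<or> a s = 1" if "a \<in> inputs S" for a
    using that assms(2) by (auto simp: PiE_iff)
  have h: "?h a \<in> inputs S" "?h (?h a) = a" if "a \<in> inputs S" for a
    using that assms(2) bin[OF that] by (auto simp: PiE_iff extensional_def fun_eq_iff)
  have "(\<Prod>t\<in>S. (-1) ^ ?h a t) = - (\<Prod>t\<in>S. (-1::complex) ^ a t)" if "a \<in> inputs S" for a
  proof -
    have "(\<Prod>t\<in>S - {s}. (-1) ^ ?h a t) = (\<Prod>t\<in>S - {s}. (-1::complex) ^ a t)"
      by (intro prod.cong) auto
    with bin[OF that] show ?thesis
      by (auto simp: prod.remove[OF assms(1,2)])
  qed
  then have neg: "?g (?h a) = - ?g a" if "a \<in> inputs S" for a
    using that inv by simp
  have "sum ?g (inputs S) = (\<Sum>a\<in>inputs S. - ?g a)"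
    by (rule sum.reindex_bij_witness[of _ ?h ?h]) (use h neg in auto)
  then show ?thesis
    by (simp add: sum_negf)
qed

section \<open>Invariance of the vacuum under number-preserving operations\<close>

lemma dilation_map_vacuum:
  assumes "finite S" "finite E" "S \<inter> E = {}"
    and U: "unitary_oper (F_basis (S \<union> E)) U" "number_preserving (F_basis (S \<union> E)) U"
  shows "dilation_map S E U (ketbra {} {}) = ketbra {} {}"
proof -
  let ?B = "F_basis (S \<union> E)"
  have fin: "finite ?B" and e: "{} \<in> ?B"
    using assms by (auto simp: finite_F_basis empty_in_F_basis)
  have U0: "U R {} = 0" if "R \<noteq> {}" for R
  proof (cases "R \<in> ?B")
    case True
    \<comment> \<open>\<open>card\<close> is 0 on infinite sets as well, so finiteness is what makes
      a nonempty \<open>R\<close> differ from the vacuum in particle number.\<close>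
    then have "finite R"
      using assms(1,2) by (auto simp: F_basis_def intro: finite_subset)
    then have "card R \<noteq> card {}"
      using that by simp
    then show ?thesis
      using U(2) True e unfolding number_preserving_def by blast
  next
    case False
    then show ?thesis
      using U(1) by (simp add: unitary_oper_def is_oper_def)
  qed
  \<comment> \<open>The vacuum is an eigenvector of \<open>U\<close>. The vacuum entry of
    \<open>U^dagger U\<close> shows that its eigenvalue is a phase, which then cancels in the
    conjugation by \<open>U\<close>.\<close>
  have "mult_oper ?B (adj_oper U) U {} {} = 1"
    using U(1) e by (simp add: unitary_oper_def id_oper_def)
  also have "mult_oper ?B (adj_oper U) U {} {} = (\<Sum>Q\<in>?B. if Q = {} then cnj (U {} {}) * U {} {} else 0)"
    unfolding mult_oper_def adj_oper_def by (intro sum.cong) (auto simp: U0)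
  finally have U1: "U {} {} * cnj (U {} {}) = 1"
    using fin e by (simp add: mult.commute)
  have tens: "tensor_oper S E (ketbra {} {}) (ketbra {} {}) = ketbra {} {}"
    unfolding tensor_oper_def ketbra_def by (intro ext) auto
  have inner: "mult_oper ?B (ketbra {} {}) (adj_oper U) Q T =
      (if Q = {} then cnj (U T {}) else 0)" for Q T
  proof -
    have "mult_oper ?B (ketbra {} {}) (adj_oper U) Q T =
        (\<Sum>Q'\<in>?B. if Q' = {} then (if Q = {} then cnj (U T {}) else 0) else 0)"
      unfolding mult_oper_def ketbra_def adj_oper_def by (intro sum.cong) auto
    then show ?thesis
      using fin e by simp
  qed
  have outer: "mult_oper ?B U (mult_oper ?B (ketbra {} {}) (adj_oper U)) = ketbra {} {}"
  proof (intro ext)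
    fix R T
    have "mult_oper ?B U (mult_oper ?B (ketbra {} {}) (adj_oper U)) R T =
        (\<Sum>Q\<in>?B. if Q = {} then U R {} * cnj (U T {}) else 0)"
      unfolding mult_oper_def[of ?B U] inner by (intro sum.cong) auto
    also have "\<dots> = U R {} * cnj (U T {})"
      using fin e by simp
    also have "\<dots> = ketbra {} {} R T"
      using U1 U0 by (auto simp: ketbra_def)
    finally show "mult_oper ?B U (mult_oper ?B (ketbra {} {}) (adj_oper U)) R T = ketbra {} {} R T" .
  qed
  show ?thesis
  proof (intro ext)
    fix R T
    \<comment> \<open>The output is the joint vacuum, so only the empty ancilla configuration
      contributes to the partial trace.\<close>
    have "(\<Sum>Q\<in>F_basis E. ketbra {} {} (R \<union> Q) (T \<union> Q)) =
        (\<Sum>Q\<in>F_basis E. if Q = {} then ketbra {} {} R T else 0)"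
      by (intro sum.cong) (auto simp: ketbra_def)
    also have "\<dots> = ketbra {} {} R T"
      using assms(2) by (simp add: finite_F_basis empty_in_F_basis)
    finally show "dilation_map S E U (ketbra {} {}) R T = ketbra {} {} R T"
      unfolding dilation_map_def tens outer partial_trace_def
      using empty_in_F_basis[of S] by (auto simp: ketbra_def)
  qed
qed

lemma joint_NPE_vacuum:
  assumes "finite S" "joint_NPE S \<Phi>"
  shows "\<Phi> (ketbra {} {}) = ketbra {} {}"
proof -
  obtain n :: nat and w :: "nat \<Rightarrow> real" and E U where w: "(\<Sum>k<n. w k) = 1"
    and E: "\<forall>k<n. finite (E k) \<and> S \<inter> E k = {} \<and> unitary_oper (F_basis (S \<union> E k)) (U k) \<and>
           number_preserving (F_basis (S \<union> E k)) (U k)"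
    and \<Phi>: "\<Phi> = (\<lambda>X R T. \<Sum>k<n. complex_of_real (w k) * dilation_map S (E k) (U k) X R T)"
    using assms(2) unfolding joint_NPE_def by blast
  have "\<Phi> (ketbra {} {}) R T = (\<Sum>k<n. complex_of_real (w k) * ketbra {} {} R T)" for R T
    unfolding \<Phi> using E assms(1) by (intro sum.cong) (auto simp: dilation_map_vacuum)
  then show ?thesis
    using w by (intro ext) (simp add: sum_distrib_right[symmetric] of_real_sum[symmetric])
qed

section \<open>Channels that multiply occupation states by phases\<close>

definition diag_map :: "nat set \<Rightarrow> (config \<Rightarrow> complex) \<Rightarrow> oper \<Rightarrow> oper" where
  "diag_map S d X = (\<lambda>R T. if R \<in> F_basis S \<and> T \<in> F_basis S then d R * X R T * cnj (d T) else 0)"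

text \<open>The channel is conjugation by a diagonal unitary, which conserves particle number; it is
  written as a mixture with a single branch and an empty set of ancillas.\<close>

lemma joint_NPE_diag_map:
  assumes S: "finite S" and d: "\<And>R. R \<in> F_basis S \<Longrightarrow> cnj (d R) * d R = 1"
  shows "joint_NPE S (diag_map S d)"
proof -
  let ?B = "F_basis S"
  \<comment> \<open>The cut-off to \<open>?B\<close> is there because \<open>is_oper\<close> demands
    zero entries outside the basis, where \<open>d\<close> is arbitrary.\<close>
  let ?U = "\<lambda>R T. if R = T \<and> R \<in> ?B then d R else 0"
  have fin: "finite ?B"
    using S by (rule finite_F_basis)
  have U_left: "mult_oper ?B ?U X R T = (if R \<in> ?B then d R * X R T else 0)" for X R T
  proof -
    have "mult_oper ?B ?U X R T = (\<Sum>Q\<in>?B. if Q = R then d R * X R T else 0)"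
      unfolding mult_oper_def by (intro sum.cong) auto
    then show ?thesis
      using fin by simp
  qed
  have U_right: "mult_oper ?B X (adj_oper ?U) R T = (if T \<in> ?B then X R T * cnj (d T) else 0)"
    for X R T
  proof -
    have "mult_oper ?B X (adj_oper ?U) R T = (\<Sum>Q\<in>?B. if Q = T then X R T * cnj (d T) else 0)"
      unfolding mult_oper_def adj_oper_def by (intro sum.cong) auto
    then show ?thesis
      using fin by simp
  qed
  have "mult_oper ?B (adj_oper ?U) ?U R T = id_oper ?B R T" for R T
  proof -
    have "mult_oper ?B (adj_oper ?U) ?U R T = (\<Sum>Q\<in>?B. if Q = T then (if R = T then 1 else 0) else 0)"
      unfolding mult_oper_def adj_oper_def by (intro sum.cong) (auto simp: d)
    then show ?thesis
      using fin by (auto simp: id_oper_def)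
  qed
  moreover have "mult_oper ?B ?U (adj_oper ?U) = id_oper ?B"
    using d unfolding U_left by (intro ext) (auto simp: adj_oper_def id_oper_def mult.commute)
  ultimately have "unitary_oper ?B ?U"
    by (auto simp: unitary_oper_def is_oper_def)
  moreover have "number_preserving ?B ?U"
    by (auto simp: number_preserving_def)
  moreover have "dilation_map S {} ?U X = diag_map S d X" for X
    unfolding dilation_map_def Un_empty_right U_left U_right partial_trace_def F_basis_empty
    by (intro ext) (auto simp: diag_map_def tensor_oper_def ketbra_def F_basis_def Int_absorb2)
  ultimately show ?thesis
    unfolding joint_NPE_def
    by (intro exI[of _ 1] exI[of _ "\<lambda>_. 1"] exI[of _ "\<lambda>_. {}"] exI[of _ "\<lambda>_. ?U"]) auto
qed

text \<open>A diagonal channel maps a matrix unit to a multiple of itself. Hence only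
  \<open>T = R\<close>, \<open>T' = R'\<close> survives in the double sum, with the product of the
  local phases as coefficient.\<close>

lemma tensor_map_diag_map:
  assumes fin: "finite (\<Union>P)" and R: "R \<in> prod_basis P" "R' \<in> prod_basis P"
  shows "tensor_map P (\<lambda>S. diag_map S (d S)) X R R' =
    X R R' * (\<Prod>S\<in>P. d S (R \<inter> S) * cnj (d S (R' \<inter> S)))"
proof -
  let ?c = "\<Prod>S\<in>P. d S (R \<inter> S) * cnj (d S (R' \<inter> S))"
  let ?G = "\<lambda>T T'. \<Prod>S\<in>P. diag_map S (d S) (ketbra (T \<inter> S) (T' \<inter> S)) (R \<inter> S) (R' \<inter> S)"
  have finP: "finite P"
    using fin by (rule finite_UnionD)
  have F: "R \<inter> S \<in> F_basis S" "R' \<inter> S \<in> F_basis S" if "S \<in> P" for S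
    using R that by (auto simp: prod_basis_def)
  have G: "?G T T' = (if T' = R' then (if T = R then ?c else 0) else 0)"
    if T: "T \<in> prod_basis P" "T' \<in> prod_basis P" for T T'
  proof (cases "T = R \<and> T' = R'")
    case True
    then show ?thesis
      by (auto simp: diag_map_def ketbra_def F)
  next
    case False
    \<comment> \<open>Configurations are determined by their restrictions to the groups, so a
      mismatch shows up in some group, whose factor is then zero.\<close>
    then obtain S where "S \<in> P" "R \<inter> S \<noteq> T \<inter> S \<or> R' \<inter> S \<noteq> T' \<inter> S"
      using prod_basis_eqI T R by metis
    then have "?G T T' = 0"
      using finP by (intro prod_zero) (auto simp: diag_map_def ketbra_def)
    then show ?thesis
      using False by auto
  qed
  have "tensor_map P (\<lambda>S. diag_map S (d S)) X R R' =
      (\<Sum>T\<in>prod_basis P. \<Sum>T'\<in>prod_basis P. X T T' * ?G T T')"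
    using R by (simp add: tensor_map_def)
  also have "\<dots> = (\<Sum>T\<in>prod_basis P. \<Sum>T'\<in>prod_basis P.
      if T' = R' then (if T = R then X R R' * ?c else 0) else 0)"
    by (intro sum.cong refl) (auto simp: G)
  also have "\<dots> = X R R' * ?c"
    using finite_prod_basis[OF fin] R by simp
  finally show ?thesis .
qed

section \<open>A two-outcome measurement sensitive to one coherence\<close>

definition fringe_oper :: "config set \<Rightarrow> config \<Rightarrow> config \<Rightarrow> complex \<Rightarrow> oper" where
  "fringe_oper B A C u =
     (\<lambda>R T. (id_oper B R T + u * ketbra A C R T + cnj u * ketbra C A R T) / 2)"

text \<open>The pairing is entrywise, without transposition. It gives the quadratic form of the
  effect for \<open>X R T = cnj (v R) * v T\<close>, and the outcome probability when
  \<open>X\<close> is the transposed state.\<close>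

lemma sum_fringe_oper:
  assumes "finite B" "A \<in> B" "C \<in> B"
  shows "(\<Sum>R\<in>B. \<Sum>T\<in>B. fringe_oper B A C u R T * X R T) =
    ((\<Sum>R\<in>B. X R R) + u * X A C + cnj u * X C A) / 2"
proof -
  have ket: "(\<Sum>R\<in>B. \<Sum>T\<in>B. ketbra A' C' R T * X R T) = X A' C'"
    if "A' \<in> B" "C' \<in> B" for A' C'
  proof -
    have "(\<Sum>R\<in>B. \<Sum>T\<in>B. ketbra A' C' R T * X R T) =
        (\<Sum>R\<in>B. \<Sum>T\<in>B. if T = C' then (if R = A' then X A' C' else 0) else 0)"
      by (intro sum.cong) (auto simp: ketbra_def)
    then show ?thesis
      using assms(1) that by simp
  qed
  have "(\<Sum>R\<in>B. \<Sum>T\<in>B. id_oper B R T * X R T) = (\<Sum>R\<in>B. \<Sum>T\<in>B. if T = R then X R R else 0)"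
    by (intro sum.cong) (auto simp: id_oper_def)
  also have "\<dots> = (\<Sum>R\<in>B. X R R)"
    using assms(1) by simp
  finally have idd: "(\<Sum>R\<in>B. \<Sum>T\<in>B. id_oper B R T * X R T) = (\<Sum>R\<in>B. X R R)" .
  have "(\<Sum>R\<in>B. \<Sum>T\<in>B. fringe_oper B A C u R T * X R T) =
      ((\<Sum>R\<in>B. \<Sum>T\<in>B. id_oper B R T * X R T) + u * (\<Sum>R\<in>B. \<Sum>T\<in>B. ketbra A C R T * X R T)
       + cnj u * (\<Sum>R\<in>B. \<Sum>T\<in>B. ketbra C A R T * X R T)) / 2"
    unfolding fringe_oper_def sum_distrib_left sum.distrib[symmetric] sum_divide_distrib
    by (intro sum.cong refl) (simp add: algebra_simps)
  then show ?thesis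
    using assms by (simp add: ket idd)
qed

text \<open>Completing the square turns twice the quadratic form into
  \<open>|v A + u * v C|^2\<close> plus the squared moduli of the remaining coordinates.\<close>

lemma positive_fringe_oper:
  assumes B: "finite B" "A \<in> B" "C \<in> B" "A \<noteq> C" and u: "cmod u = 1"
  shows "positive_oper B (fringe_oper B A C u)"
  unfolding positive_oper_def
proof (intro conjI allI)
  show "is_oper B (fringe_oper B A C u)"
    using B by (auto simp: is_oper_def fringe_oper_def id_oper_def ketbra_def)
  fix v :: "config \<Rightarrow> complex"
  have uu: "cnj u * u = 1"
    using u by (simp add: complex_norm_square[symmetric] mult.commute)
  have "(\<Sum>R\<in>B. \<Sum>T\<in>B. cnj (v R) * fringe_oper B A C u R T * v T) =
      (\<Sum>R\<in>B. \<Sum>T\<in>B. fringe_oper B A C u R T * (cnj (v R) * v T))"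
    by (simp add: mult_ac)
  also have "\<dots> = ((\<Sum>R\<in>B. cnj (v R) * v R) + u * (cnj (v A) * v C) + cnj u * (cnj (v C) * v A)) / 2"
    using B by (subst sum_fringe_oper) auto
  also have "(\<Sum>R\<in>B. cnj (v R) * v R) =
      (\<Sum>R\<in>B - {A} - {C}. cnj (v R) * v R) + cnj (v C) * v C + cnj (v A) * v A"
    using B by (simp add: sum.remove[of B A] sum.remove[of "B - {A}" C])
  \<comment> \<open>The inserted factor 1 turns this term into \<open>|u * v C|^2\<close>, the last
    piece of the square.\<close>
  also have "cnj (v C) * v C = (cnj u * u) * (cnj (v C) * v C)"
    using uu by simp
  also have "((\<Sum>R\<in>B - {A} - {C}. cnj (v R) * v R) + (cnj u * u) * (cnj (v C) * v C) + cnj (v A) * v A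
        + u * (cnj (v A) * v C) + cnj u * (cnj (v C) * v A)) / 2 =
      ((\<Sum>R\<in>B - {A} - {C}. cnj (v R) * v R) + cnj (v A + u * v C) * (v A + u * v C)) / 2"
    by (simp add: algebra_simps)
  also have "\<dots> = complex_of_real
      (((\<Sum>R\<in>B - {A} - {C}. (cmod (v R))\<^sup>2) + (cmod (v A + u * v C))\<^sup>2) / 2)"
    by (simp only: of_real_divide of_real_add of_real_sum complex_norm_square of_real_numeral
        mult.commute[of "cnj _"])
  finally show "(\<Sum>R\<in>B. \<Sum>T\<in>B. cnj (v R) * fringe_oper B A C u R T * v T) \<in> \<real>\<^sub>\<ge>\<^sub>0"
    by (simp only: nonneg_Reals_of_real_iff) (simp add: sum_nonneg)
qed

text \<open>Changing \<open>u\<close> to \<open>- u\<close> reverses the coherence terms, so they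
  cancel in the sum of the two effects.\<close>

lemma binary_POVM_fringe_oper:
  assumes "finite B" "A \<in> B" "C \<in> B" "A \<noteq> C" "cmod u = 1"
  shows "binary_POVM B (\<lambda>b. fringe_oper B A C (if b = 0 then u else - u))"
  unfolding binary_POVM_def
proof
  show "\<forall>b\<in>{0, 1}. positive_oper B (fringe_oper B A C (if b = 0 then u else - u))"
    using assms by (simp add: positive_fringe_oper)
  show "(\<lambda>R T. \<Sum>b\<in>{0::nat, 1}. fringe_oper B A C (if b = 0 then u else - u) R T) = id_oper B"
    by (simp add: fringe_oper_def add_divide_distrib[symmetric])
qed

text \<open>Polarization: the quadratic form is real at the vectors (1,0), (0,1), (1,1) and (1,i) on
  the coordinates \<open>A\<close>, \<open>C\<close>. The first two make the diagonal entries real;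
  (1,1) then compares imaginary parts of the off-diagonal entries and (1,i) their real
  parts.\<close>

lemma positive_oper_hermitian:
  assumes X: "positive_oper B X" and B: "finite B" "A \<in> B" "C \<in> B" "A \<noteq> C"
  shows "X C A = cnj (X A C)"
proof -
  have form: "(cnj x * X A A * x + cnj x * X A C * y + cnj y * X C A * x + cnj y * X C C * y) \<in> \<real>\<^sub>\<ge>\<^sub>0"
    for x y
  proof -
    let ?v = "\<lambda>R. if R = A then x else if R = C then y else 0"
    have "(\<Sum>R\<in>B. \<Sum>T\<in>B. cnj (?v R) * X R T * ?v T) =
        (\<Sum>R\<in>{A, C}. \<Sum>T\<in>{A, C}. cnj (?v R) * X R T * ?v T)"
      using B by (intro sum.mono_neutral_cong_right) (auto intro!: sum.mono_neutral_right)
    also have "\<dots> = cnj x * X A A * x + cnj x * X A C * y + cnj y * X C A * x + cnj y * X C C * y"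
      using B(4) by auto
    finally have eq: "(\<Sum>R\<in>B. \<Sum>T\<in>B. cnj (?v R) * X R T * ?v T) =
        cnj x * X A A * x + cnj x * X A C * y + cnj y * X C A * x + cnj y * X C C * y" .
    have "(\<Sum>R\<in>B. \<Sum>T\<in>B. cnj (?v R) * X R T * ?v T) \<in> \<real>\<^sub>\<ge>\<^sub>0"
      using X unfolding positive_oper_def by (elim conjE allE[of _ ?v])
    then show ?thesis
      unfolding eq .
  qed
  show ?thesis
    using form[of 1 0] form[of 0 1] form[of 1 1] form[of 1 \<i>]
    by (auto simp: complex_nonneg_Reals_iff complex_eq_iff)
qed

text \<open>Only the particle sector carries the sign: a sign shared with the vacuum would cancel
  under conjugation.\<close>

definition parity_phase :: "(nat \<Rightarrow> nat) \<Rightarrow> nat set \<Rightarrow> config \<Rightarrow> complex" where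
  "parity_phase a S R = (if R = {} then 1 else (\<Prod>s\<in>S. (-1) ^ a s))"

lemma parity_phase_restrict: "parity_phase (restrict a S) S = parity_phase a S"
  by (auto simp: parity_phase_def)

lemma cnj_parity_phase [simp]: "cnj (parity_phase a S R) = parity_phase a S R"
  by (simp add: parity_phase_def)

lemma parity_phase_square [simp]: "parity_phase a S R * parity_phase a S R = 1"
  by (simp add: parity_phase_def prod.distrib[symmetric] power_mult_distrib[symmetric])

section \<open>Diagonal states have no interference of order \<open>2 * K\<close>\<close>

lemma diagonal_no_interference:
  fixes N K :: nat
  assumes K: "1 \<le> K" and \<rho>: "density_oper (H1_basis N) \<rho>"
    and diag: "\<And>i j. i \<in> {1..N} \<Longrightarrow> j \<in> {1..N} \<Longrightarrow> i \<noteq> j \<Longrightarrow> \<rho> {i} {j} = 0"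
    and p: "p \<in> local_quantum_MACs N K \<rho>"
    and Z: "Z \<subseteq> {1..N}" "card Z = 2 * K" and c: "c \<in> inputs ({1..N} - Z)"
  shows "interference p Z c = 0"
proof -
  obtain P \<E> M where P: "partition_on {1..N} P" and cardP: "\<forall>S\<in>P. card S \<le> K"
    and NPE: "\<forall>S\<in>P. \<forall>a\<in>inputs S. joint_NPE S (\<E> S a)"
    and pM: "\<forall>b\<in>{0, 1}. \<forall>a\<in>inputs {1..N}.
        complex_of_real (p b a) =
          trace_oper (prod_basis P)
            (mult_oper (prod_basis P) (M b) (tensor_map P (\<lambda>S. \<E> S (restrict a S)) \<rho>))"
    using p unfolding local_quantum_MACs_def by blast
  let ?B = "prod_basis P"
  have UP: "\<Union>P = {1..N}"
    using P by (simp add: partition_on_def)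
  have finS: "finite S" if "S \<in> P" for S
    using UP that by (metis Union_upper finite_atLeastAtMost finite_subset)
  have finZ: "finite Z"
    using Z(1) finite_subset by blast
  define ov where "ov a = override_on c a Z" for a
  have ov_in: "ov a \<in> inputs {1..N}" if "a \<in> inputs Z" for a
    using that c Z(1) unfolding ov_def
    by (auto simp: PiE_iff override_on_def extensional_def)
  \<comment> \<open>All dependence on the inputs sits in \<open>G\<close>, so the alternating sum
    can be evaluated separately for each choice of matrix entries.\<close>
  define G where "G T T' R Q a =
    (\<Prod>S\<in>P. \<E> S (restrict (ov a) S) (ketbra (T \<inter> S) (T' \<inter> S)) (Q \<inter> S) (R \<inter> S))" for T T' R Q a
  have p0: "complex_of_real (p 0 (ov a)) =
      (\<Sum>R\<in>?B. \<Sum>Q\<in>?B. \<Sum>T\<in>?B. \<Sum>T'\<in>?B. M 0 R Q * \<rho> T T' * G T T' R Q a)"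
    if "a \<in> inputs Z" for a
  proof -
    have "complex_of_real (p 0 (ov a)) = trace_oper ?B
        (mult_oper ?B (M 0) (tensor_map P (\<lambda>S. \<E> S (restrict (ov a) S)) \<rho>))"
      using pM ov_in[OF that] by simp
    also have "\<dots> = (\<Sum>R\<in>?B. \<Sum>Q\<in>?B. \<Sum>T\<in>?B. \<Sum>T'\<in>?B. M 0 R Q * \<rho> T T' * G T T' R Q a)"
      unfolding trace_oper_def mult_oper_def
      by (intro sum.cong refl) (simp add: tensor_map_def G_def sum_distrib_left mult.assoc)
    finally show ?thesis .
  qed
  have zero: "(\<Sum>a\<in>inputs Z. (\<Prod>s\<in>Z. (-1) ^ a s) * (M 0 R Q * \<rho> T T' * G T T' R Q a)) = 0"
    for R Q T T'
  proof (cases "\<rho> T T' = 0")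
    case False
    then have "T \<in> H1_basis N" "T' \<in> H1_basis N"
      using \<rho> by (auto simp: density_oper_def positive_oper_def is_oper_def)
    with False diag obtain k where k: "k \<in> {1..N}" "T = {k}" "T' = {k}"
      unfolding H1_basis_def by blast
    then obtain S0 where S0: "S0 \<in> P" "k \<in> S0"
      using UP by blast
    \<comment> \<open>The group of the particle has at most \<open>K\<close> senders, fewer than the
      \<open>2 * K\<close> in \<open>Z\<close> since \<open>K\<close> is positive. Some
      \<open>s\<close> in \<open>Z\<close> is therefore outside it, and flipping that input will not
      affect \<open>G\<close>.\<close>
    have "\<not> Z \<subseteq> S0"
      using card_mono[OF finS[OF S0(1)], of Z] cardP S0(1) Z(2) K by force
    then obtain s where s: "s \<in> Z" "s \<notin> S0"
      by blast
    have "G T T' R Q (a(s := 1 - a s)) = G T T' R Q a" if a: "a \<in> inputs Z" for a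
      unfolding G_def
    proof (intro prod.cong refl)
      fix S
      assume S: "S \<in> P"
      let ?a' = "a(s := 1 - a s)"
      have a': "?a' \<in> inputs Z"
        using a s(1) by (auto simp: PiE_iff extensional_def)
      show "\<E> S (restrict (ov ?a') S) (ketbra (T \<inter> S) (T' \<inter> S)) (Q \<inter> S) (R \<inter> S) =
          \<E> S (restrict (ov a) S) (ketbra (T \<inter> S) (T' \<inter> S)) (Q \<inter> S) (R \<inter> S)"
      proof (cases "S = S0")
        case True
        then have "restrict (ov ?a') S = restrict (ov a) S"
          using s(2) by (auto simp: ov_def override_on_def)
        then show ?thesis
          by simp
      next
        case False
        then have "k \<notin> S"
          using P S S0 by (auto simp: partition_on_def disjoint_def)
        then have emp: "T \<inter> S = {}" "T' \<inter> S = {}"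
          using k by auto
        \<comment> \<open>Other groups may see the flipped input, but they act on the vacuum, which
          the channel for either input fixes.\<close>
        have vac: "\<E> S (restrict (ov b) S) (ketbra {} {}) = ketbra {} {}" if "b \<in> inputs Z" for b
        proof -
          have "S \<subseteq> {1..N}"
            using UP S by blast
          then have "restrict (ov b) S \<in> inputs S"
            using ov_in[OF that] by (auto simp: PiE_iff subset_iff)
          then show ?thesis
            using NPE S by (intro joint_NPE_vacuum[OF finS[OF S]]) blast
        qed
        show ?thesis
          unfolding emp by (simp only: vac[OF a] vac[OF a'])
      qed
    qed
    then show ?thesis
      by (intro alternating_sum_eq_0[OF finZ s(1)]) simp
  qed simp
  have "complex_of_real (interference p Z c) =
      (\<Sum>a\<in>inputs Z. (\<Prod>s\<in>Z. (-1) ^ a s) * complex_of_real (p 0 (ov a)))"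
    unfolding interference_def ov_def by simp
  also have "\<dots> = (\<Sum>a\<in>inputs Z. \<Sum>R\<in>?B. \<Sum>Q\<in>?B. \<Sum>T\<in>?B. \<Sum>T'\<in>?B.
      (\<Prod>s\<in>Z. (-1) ^ a s) * (M 0 R Q * \<rho> T T' * G T T' R Q a))"
    by (intro sum.cong refl) (simp add: p0 sum_distrib_left)
  \<comment> \<open>The instance of \<open>sum.swap\<close> fixes both index sets, so rewriting only
    moves the sum over \<open>a\<close> inward and terminates.\<close>
  also have "\<dots> = (\<Sum>R\<in>?B. \<Sum>Q\<in>?B. \<Sum>T\<in>?B. \<Sum>T'\<in>?B. \<Sum>a\<in>inputs Z.
      (\<Prod>s\<in>Z. (-1) ^ a s) * (M 0 R Q * \<rho> T T' * G T T' R Q a))"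
    by (simp only: sum.swap[of _ ?B "inputs Z"])
  also have "\<dots> = 0"
    by (simp only: zero sum.neutral_const)
  finally show ?thesis
    by simp
qed

section \<open>An off-diagonal term yields interference of order \<open>2 * K\<close>\<close>

lemma obtain_disjoint_groups:
  assumes "1 \<le> K" "2 * K \<le> N" "i \<in> {1..N}" "j \<in> {1..N}" "i \<noteq> j"
  obtains S T where "S \<subseteq> {1..N::nat}" "T \<subseteq> {1..N}" "S \<inter> T = {}" "card S = K" "card T = K"
    "i \<in> S" "j \<in> T"
proof -
  \<comment> \<open>With \<open>i\<close> and \<open>j\<close> set aside, the other
    \<open>N - 2\<close> modes have room for two disjoint sets of size \<open>K - 1\<close>, because
    \<open>2 * K \<le> N\<close>.\<close>
  have "K - 1 \<le> card ({1..N} - {i, j})"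
    using assms by (simp add: card_Diff_subset)
  then obtain S' where S': "S' \<subseteq> {1..N} - {i, j}" "card S' = K - 1" "finite S'"
    by (rule obtain_subset_with_card_n)
  have "K - 1 \<le> card ({1..N} - {i, j} - S')"
    using assms S' by (simp add: card_Diff_subset)
  then obtain T' where T': "T' \<subseteq> {1..N} - {i, j} - S'" "card T' = K - 1" "finite T'"
    by (rule obtain_subset_with_card_n)
  have "i \<notin> S'" "j \<notin> T'"
    using S' T' by auto
  then show ?thesis
    using S' T' assms by (intro that[of "insert i S'" "insert j T'"]) auto
qed

text \<open>\<open>S\<close> contains \<open>i\<close> but not \<open>j\<close>, so its sign enters
  once; the same holds for \<open>T\<close> with the roles exchanged. Every other group is empty in
  both configurations and contributes 1.\<close>

lemma prod_parity_phase_coherence: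
  assumes P: "partition_on A P" and fin: "finite A"
    and S: "S \<in> P" "T \<in> P" "S \<noteq> T" "i \<in> S" "j \<in> T"
  shows "(\<Prod>Q\<in>P. parity_phase a Q ({i} \<inter> Q) * parity_phase a Q ({j} \<inter> Q)) =
    (\<Prod>s\<in>S \<union> T. (-1) ^ a s)"
proof -
  have finP: "finite P"
    using P fin by (metis finite_UnionD partition_onD1)
  have ST: "S \<inter> T = {}" "finite S" "finite T"
    using P S fin by (auto simp: partition_on_def disjoint_def intro: finite_subset)
  have "(\<Prod>Q\<in>P. parity_phase a Q ({i} \<inter> Q) * parity_phase a Q ({j} \<inter> Q)) =
      (\<Prod>Q\<in>{S, T}. \<Prod>s\<in>Q. (-1) ^ a s)"
  proof (intro prod.mono_neutral_cong_right)
    have notin: "i \<notin> Q" if "Q \<in> P" "Q \<noteq> S" for Q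
      using that P S by (auto simp: partition_on_def disjoint_def)
    have notin': "j \<notin> Q" if "Q \<in> P" "Q \<noteq> T" for Q
      using that P S by (auto simp: partition_on_def disjoint_def)
    show "\<forall>Q\<in>P - {S, T}. parity_phase a Q ({i} \<inter> Q) * parity_phase a Q ({j} \<inter> Q) = 1"
      using notin notin' by (simp add: parity_phase_def)
    show "parity_phase a Q ({i} \<inter> Q) * parity_phase a Q ({j} \<inter> Q) = (\<Prod>s\<in>Q. (-1) ^ a s)"
      if "Q \<in> {S, T}" for Q
      using that S notin[of T] notin'[of S] by (auto simp: parity_phase_def)
  qed (use finP S in auto)
  also have "\<dots> = (\<Prod>s\<in>S \<union> T. (-1) ^ a s)"
    using S(3) ST by (simp add: prod.union_disjoint)
  finally show ?thesis .
qed

lemma coherence_interference: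
  fixes N K :: nat
  assumes K: "1 \<le> K" "2 * K \<le> N" and \<rho>: "density_oper (H1_basis N) \<rho>"
    and ij: "i \<in> {1..N}" "j \<in> {1..N}" "i \<noteq> j" "\<rho> {i} {j} \<noteq> 0"
  shows "\<exists>p\<in>local_quantum_MACs N K \<rho>. nonvanishing_interference N (2 * K) p"
proof -
  obtain S T where ST: "S \<subseteq> {1..N}" "T \<subseteq> {1..N}" "S \<inter> T = {}" "card S = K" "card T = K"
    "i \<in> S" "j \<in> T"
    using obtain_disjoint_groups[OF K ij(1-3)] .
  define Z where "Z = S \<union> T"
  \<comment> \<open>The remaining senders form singleton groups, whose size is within the bound as
    \<open>K\<close> is at least 1.\<close>
  define P where "P = {S, T} \<union> (\<lambda>k. {k}) ` ({1..N} - Z)"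
  have UP: "\<Union>P = {1..N}"
    using ST by (auto simp: P_def Z_def)
  have P: "partition_on {1..N} P"
    using UP ST unfolding partition_on_def disjoint_def by (auto simp: P_def Z_def)
  have SP: "S \<in> P" "T \<in> P" "S \<noteq> T"
    using ST by (auto simp: P_def)
  have cardP: "\<forall>Q\<in>P. card Q \<le> K"
    using ST K by (auto simp: P_def)
  have finZ: "finite Z" "Z \<subseteq> {1..N}"
    using ST finite_subset[of _ "{1..N}"] by (auto simp: Z_def)
  have cardZ: "card Z = 2 * K"
    using ST K by (auto simp: Z_def card_Un_disjoint finite_subset[of _ "{1..N}"])
  let ?B = "prod_basis P"
  have finB: "finite ?B" and ijB: "{i} \<in> ?B" "{j} \<in> ?B"
    using UP ij by (auto intro: finite_prod_basis singleton_in_prod_basis)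
  define z where "z = \<rho> {i} {j}"
  \<comment> \<open>The trace pairs \<open>u\<close> with the entry \<open>\<rho> {j} {i}\<close>,
    which is \<open>cnj z\<close>. With this phase both coherence terms have the real coefficient
    \<open>cmod z\<close>.\<close>
  define u where "u = z / cmod z"
  have z: "z \<noteq> 0"
    using ij by (simp add: z_def)
  have zz: "cnj z * z = (cmod z)\<^sup>2"
    by (simp only: complex_norm_square mult.commute)
  have u: "cmod u = 1" "u * cnj z = cmod z" "cnj u * z = cmod z"
    using z zz by (simp_all add: u_def norm_divide divide_simps power2_eq_square mult.commute)
  have herm: "\<rho> {j} {i} = cnj z"
    unfolding z_def using \<rho> ij
    by (intro positive_oper_hermitian[of "H1_basis N"]) (auto simp: density_oper_def H1_basis_def)
  define M where "M b = fringe_oper ?B {i} {j} (if b = 0 then u else - u)" for b :: nat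
  define \<E> where "\<E> Q a = diag_map Q (parity_phase a Q)" for Q a
  define p where "p b a = 1/2 + (if b = 0 then 1 else -1) * cmod z * (\<Prod>s\<in>Z. (-1) ^ a s)"
    for b :: nat and a :: "nat \<Rightarrow> nat"
  \<comment> \<open>\<open>?B\<close> also holds the vacuum and multi-particle configurations, where
    \<open>\<rho>\<close> vanishes.\<close>
  have tr: "(\<Sum>R\<in>?B. \<rho> R R) = 1"
  proof -
    have "(\<Sum>R\<in>?B. \<rho> R R) = (\<Sum>R\<in>H1_basis N. \<rho> R R)"
    proof (rule sum.mono_neutral_right[OF finB])
      show "H1_basis N \<subseteq> ?B"
        using UP unfolding H1_basis_def by (auto intro: singleton_in_prod_basis)
      show "\<forall>R\<in>?B - H1_basis N. \<rho> R R = 0"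
        using \<rho> by (auto simp: density_oper_def positive_oper_def is_oper_def)
    qed
    then show ?thesis
      using \<rho> by (simp add: density_oper_def trace_oper_def)
  qed
  have "complex_of_real (p b a) =
      trace_oper ?B (mult_oper ?B (M b) (tensor_map P (\<lambda>Q. \<E> Q (restrict a Q)) \<rho>))" for b a
  proof -
    let ?X = "tensor_map P (\<lambda>Q. \<E> Q (restrict a Q)) \<rho>"
    let ?\<chi> = "\<Prod>s\<in>Z. (-1::complex) ^ a s"
    let ?u = "if b = 0 then u else - u"
    have X: "?X R R' = \<rho> R R' * (\<Prod>Q\<in>P. parity_phase a Q (R \<inter> Q) * parity_phase a Q (R' \<inter> Q))"
      if "R \<in> ?B" "R' \<in> ?B" for R R'
      using tensor_map_diag_map[OF _ that] UP by (simp add: \<E>_def parity_phase_restrict)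
    \<comment> \<open>On the diagonal each parity phase meets itself and squares to 1.\<close>
    have "(\<Sum>R\<in>?B. ?X R R) = 1"
      using tr by (simp add: X)
    moreover have "?X {i} {j} = z * ?\<chi>"
      using X[OF ijB] prod_parity_phase_coherence[OF P _ SP ST(6,7), of a] by (simp add: z_def Z_def)
    moreover have "?X {j} {i} = cnj z * ?\<chi>"
      using X[OF ijB(2,1)] prod_parity_phase_coherence[OF P _ SP ST(6,7), of a]
      by (simp add: herm Z_def mult.commute)
    moreover have "trace_oper ?B (mult_oper ?B (M b) ?X) =
        ((\<Sum>R\<in>?B. ?X R R) + ?u * ?X {j} {i} + cnj ?u * ?X {i} {j}) / 2"
      unfolding trace_oper_def mult_oper_def M_def
      using sum_fringe_oper[OF finB ijB, of ?u "\<lambda>R Q. ?X Q R"] by simp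
    ultimately have "trace_oper ?B (mult_oper ?B (M b) ?X) =
        (1 + ?u * cnj z * ?\<chi> + cnj ?u * z * ?\<chi>) / 2"
      by (simp add: mult.assoc)
    also have "\<dots> = complex_of_real (p b a)"
      using u by (auto simp: p_def add_divide_distrib diff_divide_distrib)
    finally show ?thesis
      by simp
  qed
  moreover have "joint_NPE Q (\<E> Q a)" if "Q \<in> P" for Q a
    unfolding \<E>_def
  proof (rule joint_NPE_diag_map)
    show "finite Q"
      using that UP by (metis Union_upper finite_atLeastAtMost finite_subset)
  qed simp
  moreover have "binary_POVM ?B M"
    unfolding M_def using binary_POVM_fringe_oper[OF finB ijB _ u(1)] ij(3) by auto
  ultimately have "p \<in> local_quantum_MACs N K \<rho>"
    unfolding local_quantum_MACs_def mem_Collect_eq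
    using P cardP by (intro exI[of _ P] exI[of _ \<E>] exI[of _ M]) blast
  \<comment> \<open>\<open>p\<close> depends only on the inputs in \<open>Z\<close>, so those
    outside can be set to 0. The constant 1/2 cancels in the alternating sum, while the sign in
    \<open>p\<close> squares away and each input string contributes \<open>cmod z\<close>.\<close>
  moreover have "interference p Z (\<lambda>k\<in>{1..N} - Z. 0) \<noteq> 0"
  proof -
    let ?\<chi> = "\<lambda>a::nat \<Rightarrow> nat. \<Prod>s\<in>Z. (-1::real) ^ a s"
    obtain s where s: "s \<in> Z"
      using ST by (auto simp: Z_def)
    have "complex_of_real (\<Sum>a\<in>inputs Z. ?\<chi> a) = (\<Sum>a\<in>inputs Z. (\<Prod>s\<in>Z. (-1) ^ a s) * 1)"
      by simp
    also have "\<dots> = 0"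
      by (rule alternating_sum_eq_0[OF finZ(1) s]) simp
    finally have "(\<Sum>a\<in>inputs Z. ?\<chi> a) = 0"
      by (simp only: of_real_eq_0_iff)
    moreover have "interference p Z (\<lambda>k\<in>{1..N} - Z. 0) = (\<Sum>a\<in>inputs Z. ?\<chi> a * (1/2) + cmod z)"
      unfolding interference_def
    proof (intro sum.cong refl)
      fix a
      have "?\<chi> (override_on (\<lambda>k\<in>{1..N} - Z. 0) a Z) = ?\<chi> a"
        by (intro prod.cong) auto
      moreover have "?\<chi> a * ?\<chi> a = 1"
        by (simp add: prod.distrib[symmetric] power_mult_distrib[symmetric])
      ultimately show "?\<chi> a * p 0 (override_on (\<lambda>k\<in>{1..N} - Z. 0) a Z) = ?\<chi> a * (1/2) + cmod z"
        by (simp add: p_def algebra_simps)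
    qed
    ultimately have "interference p Z (\<lambda>k\<in>{1..N} - Z. 0) = card (inputs Z) * cmod z"
      by (simp add: sum.distrib sum_divide_distrib[symmetric])
    moreover have "card (inputs Z) \<noteq> 0"
      using finZ(1) by (simp add: card_PiE)
    ultimately show ?thesis
      using z by simp
  qed
  ultimately show ?thesis
    unfolding nonvanishing_interference_def using finZ(2) cardZ
    by (intro bexI[of _ p] exI[of _ Z] exI[of _ "\<lambda>k\<in>{1..N} - Z. 0"]) auto
qed

theorem proposition10:
  fixes N K :: nat and \<rho> :: oper
  assumes "1 \<le> K" and "K \<le> N div 2"
    and "density_oper (H1_basis N) \<rho>"
  shows "(\<exists>p \<in> local_quantum_MACs N K \<rho>. nonvanishing_interference N (2 * K) p) \<longleftrightarrow>
         (\<exists>i\<in>{1..N}. \<exists>j\<in>{1..N}. i \<noteq> j \<and> \<rho> {i} {j} \<noteq> 0)"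
proof
  assume "\<exists>p \<in> local_quantum_MACs N K \<rho>. nonvanishing_interference N (2 * K) p"
  then show "\<exists>i\<in>{1..N}. \<exists>j\<in>{1..N}. i \<noteq> j \<and> \<rho> {i} {j} \<noteq> 0"
    unfolding nonvanishing_interference_def
    using diagonal_no_interference[OF assms(1,3)] by blast
next
  assume "\<exists>i\<in>{1..N}. \<exists>j\<in>{1..N}. i \<noteq> j \<and> \<rho> {i} {j} \<noteq> 0"
  moreover have "2 * K \<le> N"
    using assms(2) by simp
  ultimately show "\<exists>p \<in> local_quantum_MACs N K \<rho>. nonvanishing_interference N (2 * K) p"
    using coherence_interference[OF assms(1) _ assms(3)] by blast
qed

end
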